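(* Let $RSC_n=RSC(n,p_1,p_2,p_3)$ be a random spiro chain and let $N_n=\sum_{uv\in E(RSC_n)}\sqrt{d_u+d_v}$ be the Nirmala index of $RSC_n$, with $n\ge2$. Then $$N_n=8-4\sqrt6+(2-2\sqrt6+2\sqrt2)X+(4+4\sqrt6)n,$$ $$\mathbb{E}(N_n)=8-4\sqrt6+\bigl((2-2\sqrt6+2\sqrt2)p_1+4+4\sqrt6\bigr)n-2(2-2\sqrt6+2\sqrt2)p_1,$$ $$V(N_n)=(2-2\sqrt6+2\sqrt2)^2p_1(1-p_1)(n-2),$$ where $X$ is a random variable having the binomial distribution with parameters $n-2$ and $p_1$; moreover, as $n\to\infty$, $$\frac{N_n-\mathbb{E}(N_n)}{\sqrt{V(N_n)}}\xrightarrow{D}N(0,1).$$ Here $\mathbb{E}$ and $V$ denote expectation and variance, $\xrightarrow{D}$ convergence in distribution, and $N(0,1)$ the standard normal distribution.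
   Context: For a finite simple graph $G$, $E(G)$ is its edge set and $d_v$ is the degree of the vertex $v$. Random spiro chain. Fix $p_1,p_2,p_3$ with $0<p_i<1$ and $p_1+p_2+p_3=1$. The random spiro chain $RSC_n=RSC(n,p_1,p_2,p_3)$ with $n$ hexagons is built as follows. $RSC_1$ is a hexagon $H_1$ (a 6-cycle). $RSC_2$ consists of two hexagons $H_1,H_2$ sharing exactly one vertex. For $n>2$, $RSC_n$ is obtained from $RSC_{n-1}$ by attaching a new hexagon $H_n$ to the last hexagon $H_{n-1}$, identifying one vertex of $H_n$ with a vertex $w$ of $H_{n-1}$, where $w$ is at distance $i\in\{1,2,3\}$ (in the 6-cycle $H_{n-1}$) from the vertex that $H_{n-1}$ shares with $H_{n-2}$. Case $i$ is chosen with probability $p_i$, independently of the previous choices. The first identity asserts that such a random variable $X$ exists (on the same probability space as the chain). *)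

theory Defs
  imports "HOL-Probability.Probability"
begin

text \<open>A finite simple graph without isolated vertices is represented by its set of edges, each edge
  being a two-element set of vertices; the vertex set of \<open>G\<close> is then \<open>\<Union>G\<close>.\<close>

definition degree :: "'a set set \<Rightarrow> 'a \<Rightarrow> nat" where
  "degree G v = card {e \<in> G. v \<in> e}"

text \<open>The inner sum ranges over the two endpoints of \<open>e\<close>.\<close>

definition nirmala :: "'a set set \<Rightarrow> real" where
  "nirmala G = (\<Sum>e\<in>G. sqrt (\<Sum>v\<in>e. real (degree G v)))"

definition graph_dist :: "'a set set \<Rightarrow> 'a \<Rightarrow> 'a \<Rightarrow> nat" where
  "graph_dist G u w = (LEAST k. (u, w) \<in> {(x, y). {x, y} \<in> G} ^^ k)"

definition hexagon :: "'a set set \<Rightarrow> bool" where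
  "hexagon H \<longleftrightarrow> (\<exists>a b c d e f. distinct [a, b, c, d, e, f] \<and>
     H = {{a, b}, {b, c}, {c, d}, {d, e}, {e, f}, {f, a}})"

text \<open>\<open>spiro_hexagons c [H\<^sub>n, \<dots>, H\<^sub>1]\<close>: the hexagons, last one first, form a spiro chain in which,
  for \<open>k \<ge> 3\<close>, \<open>H\<^sub>k\<close> is attached to \<open>H\<^sub>k\<^sub>-\<^sub>1\<close> at a vertex at distance \<open>c k\<close> from the vertex shared by
  \<open>H\<^sub>k\<^sub>-\<^sub>1\<close> and \<open>H\<^sub>k\<^sub>-\<^sub>2\<close>. When two vertices are at that distance, either one may be used.\<close>

inductive spiro_hexagons :: "(nat \<Rightarrow> nat) \<Rightarrow> 'a set set list \<Rightarrow> bool" for c where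
  one: "hexagon H \<Longrightarrow> spiro_hexagons c [H]"
| two: "hexagon H1 \<Longrightarrow> hexagon H2 \<Longrightarrow> \<Union>H1 \<inter> \<Union>H2 = {u} \<Longrightarrow> spiro_hexagons c [H2, H1]"
| attach: "spiro_hexagons c (H' # H'' # Hs) \<Longrightarrow> \<Union>H' \<inter> \<Union>H'' = {u} \<Longrightarrow>
     w \<in> \<Union>H' \<Longrightarrow> graph_dist H' u w = c (length Hs + 3) \<Longrightarrow> c (length Hs + 3) \<in> {1, 2, 3} \<Longrightarrow>
     hexagon H \<Longrightarrow> \<Union>H \<inter> \<Union>(\<Union>(set (H' # H'' # Hs))) = {w} \<Longrightarrow>
     spiro_hexagons c (H # H' # H'' # Hs)"

definition spiro_chain :: "(nat \<Rightarrow> nat) \<Rightarrow> nat \<Rightarrow> 'a set set \<Rightarrow> bool" where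
  "spiro_chain c n G \<longleftrightarrow> (\<exists>Hs. spiro_hexagons c Hs \<and> length Hs = n \<and> G = \<Union>(set Hs))"

text \<open>\<open>C k\<close> is the random case chosen when the \<open>k\<close>-th hexagon is attached, and \<open>RSC n\<close> is the chain of
  \<open>n\<close> hexagons built from \<open>C 3, \<dots>, C n\<close>. These choices determine it up to isomorphism only; no
  measurable choice of a representative is required.\<close>

locale random_spiro_chain = prob_space M for M :: "'w measure" +
  fixes p1 p2 p3 :: real
    and C :: "nat \<Rightarrow> 'w \<Rightarrow> nat"
    and RSC :: "nat \<Rightarrow> 'w \<Rightarrow> 'a set set"
  assumes p1: "0 < p1" "p1 < 1" and p2: "0 < p2" "p2 < 1" and p3: "0 < p3" "p3 < 1"
    and p_sum: "p1 + p2 + p3 = 1"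
    and indep: "indep_vars (\<lambda>_. count_space {1, 2, 3}) C {3..}"
    and prob_C: "\<And>k. k \<ge> 3 \<Longrightarrow> prob {\<omega> \<in> space M. C k \<omega> = 1} = p1"
      "\<And>k. k \<ge> 3 \<Longrightarrow> prob {\<omega> \<in> space M. C k \<omega> = 2} = p2"
      "\<And>k. k \<ge> 3 \<Longrightarrow> prob {\<omega> \<in> space M. C k \<omega> = 3} = p3"
    and RSC: "\<And>n \<omega>. n \<ge> 1 \<Longrightarrow> \<omega> \<in> space M \<Longrightarrow> spiro_chain (\<lambda>k. C k \<omega>) n (RSC n \<omega>)"

end

theory Submission
  imports Defs
begin

text \<open>Attaching a hexagon to a spiro chain changes degrees only at the vertex \<open>w\<close> of attachment, from 2 to
  4. Hence the Nirmala index grows by the weight of the six new edges plus the change of weight of the two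
  old edges at \<open>w\<close>. The other ends of these two have degree 2, except that one of them has degree 4 if \<open>w\<close>
  is adjacent to the previous junction. The increment is thus \<open>4 + 4\<surd>6\<close>, with an additional
  \<open>2 - 2\<surd>6 + 2\<surd>2\<close> in case 1 (\<open>nirmala_attach\<close>). Which of the vertices at the chosen distance is used
  does not matter, so the index is a function of the choices alone, although the chain is not.

  By induction along the chain (\<open>nirmala_spiro_chain\<close>), the index of a chain of \<open>n\<close> hexagons is an affine
  function of the number of steps \<open>3, \<dots>, n\<close> at which case 1 was chosen. These are \<open>n - 2\<close> independent trials
  with success probability \<open>p1\<close>, so this number is binomial (\<open>distr_card_successes\<close>), its moments give
  expectation and variance (\<open>binomial_moments\<close>), and the limit law is the central limit theorem for
  independent trials (\<open>de_Moivre_Laplace\<close>). The slope \<open>2 - 2\<surd>6 + 2\<surd>2\<close> is negative, but since the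
  standard normal distribution is symmetric the limit is the same.\<close>

section \<open>Hexagons and degrees\<close>

lemma hexagon_from_vertex:
  assumes "hexagon H" "v \<in> \<Union>H"
  obtains b c d e f where "distinct [v, b, c, d, e, f]"
    "H = {{v, b}, {b, c}, {c, d}, {d, e}, {e, f}, {f, v}}"
proof -
  obtain a b c d e f where dist: "distinct [a, b, c, d, e, f]"
    and H: "H = {{a, b}, {b, c}, {c, d}, {d, e}, {e, f}, {f, a}}"
    using assms(1) unfolding hexagon_def by blast
  have rot: "H = {{b, c}, {c, d}, {d, e}, {e, f}, {f, a}, {a, b}}"
    "H = {{c, d}, {d, e}, {e, f}, {f, a}, {a, b}, {b, c}}"
    "H = {{d, e}, {e, f}, {f, a}, {a, b}, {b, c}, {c, d}}"
    "H = {{e, f}, {f, a}, {a, b}, {b, c}, {c, d}, {d, e}}"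
    "H = {{f, a}, {a, b}, {b, c}, {c, d}, {d, e}, {e, f}}"
    unfolding H by auto
  have "v \<in> {a, b, c, d, e, f}" using assms(2) H by auto
  then consider "v = a" | "v = b" | "v = c" | "v = d" | "v = e" | "v = f" by blast
  then show thesis
  proof cases
    case 1 then show thesis using that[of b c d e f] dist H by simp
  next
    case 2 then show thesis using that[of c d e f a] dist rot(1) by auto
  next
    case 3 then show thesis using that[of d e f a b] dist rot(2) by auto
  next
    case 4 then show thesis using that[of e f a b c] dist rot(3) by auto
  next
    case 5 then show thesis using that[of f a b c d] dist rot(4) by auto
  next
    case 6 then show thesis using that[of a b c d e] dist rot(5) by auto
  qed
qed

lemma hexagon_edges_at:
  assumes "hexagon H" "v \<in> \<Union>H"
  obtains x y where "x \<noteq> y" "x \<noteq> v" "y \<noteq> v" "{e \<in> H. v \<in> e} = {{v, x}, {v, y}}"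
proof -
  obtain b c d e f where dist: "distinct [v, b, c, d, e, f]"
    and H: "H = {{v, b}, {b, c}, {c, d}, {d, e}, {e, f}, {f, v}}"
    using hexagon_from_vertex[OF assms] .
  have "{e \<in> H. v \<in> e} = {{v, b}, {v, f}}"
    unfolding H using dist by auto
  then show thesis using that[of b f] dist by auto
qed

lemma hexagon_finite: "hexagon H \<Longrightarrow> finite H"
  by (auto simp: hexagon_def)

lemma hexagon_card: "hexagon H \<Longrightarrow> card H = 6"
  by (auto simp: hexagon_def card_insert_if doubleton_eq_iff)

lemma hexagon_card_edge: "hexagon H \<Longrightarrow> e \<in> H \<Longrightarrow> card e = 2"
  by (auto simp: hexagon_def)

lemma hexagon_degree: "hexagon H \<Longrightarrow> v \<in> \<Union>H \<Longrightarrow> degree H v = 2"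
  by (erule (1) hexagon_edges_at) (auto simp: degree_def doubleton_eq_iff)

lemma graph_dist_self: "graph_dist G u u = 0"
  unfolding graph_dist_def by (rule Least_equality) auto

text \<open>The distance is defined as a least walk length, which is unspecified if there is no walk. So
  connectedness of the cycle is needed to conclude from \<open>graph_dist H u w = 1\<close> that a walk of length 1
  exists.\<close>

lemma hexagon_graph_dist_eq_1_iff:
  assumes "hexagon H" "u \<in> \<Union>H" "w \<in> \<Union>H" "w \<noteq> u"
  shows "graph_dist H u w = 1 \<longleftrightarrow> {u, w} \<in> H"
proof -
  let ?R = "{(x, y). {x, y} \<in> H}"
  let ?P = "\<lambda>k. (u, w) \<in> ?R ^^ k"
  have P0: "\<not> ?P 0" using assms(4) by auto
  have P1: "?P 1 \<longleftrightarrow> {u, w} \<in> H" by simp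
  have ex: "\<exists>k. ?P k"
  proof -
    obtain b c d e f where "distinct [u, b, c, d, e, f]"
      and H: "H = {{u, b}, {b, c}, {c, d}, {d, e}, {e, f}, {f, u}}"
      using hexagon_from_vertex[OF assms(1,2)] .
    have R: "(u, b) \<in> ?R" "(b, c) \<in> ?R" "(c, d) \<in> ?R" "(d, e) \<in> ?R" "(e, f) \<in> ?R"
      unfolding H by auto
    have "w \<in> {b, c, d, e, f}" using assms(3,4) H by auto
    moreover have "(u, b) \<in> ?R\<^sup>*" using R(1) by (rule r_into_rtrancl)
    moreover from this have "(u, c) \<in> ?R\<^sup>*" using R(2) by (rule rtrancl_into_rtrancl)
    moreover from this have "(u, d) \<in> ?R\<^sup>*" using R(3) by (rule rtrancl_into_rtrancl)
    moreover from this have "(u, e) \<in> ?R\<^sup>*" using R(4) by (rule rtrancl_into_rtrancl)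
    moreover from this have "(u, f) \<in> ?R\<^sup>*" using R(5) by (rule rtrancl_into_rtrancl)
    ultimately have "(u, w) \<in> ?R\<^sup>*" by auto
    then show ?thesis by (auto dest: rtrancl_imp_relpow)
  qed
  show ?thesis
  proof
    assume "graph_dist H u w = 1"
    then show "{u, w} \<in> H" using LeastI_ex[OF ex] P1 unfolding graph_dist_def by simp
  next
    assume "{u, w} \<in> H"
    then have "?P 1" using P1 by simp
    moreover have "1 \<le> k" if "?P k" for k using that P0 by (cases k) auto
    ultimately show "graph_dist H u w = 1"
      unfolding graph_dist_def by (rule Least_equality)
  qed
qed

lemma degree_Un_disjoint:
  assumes "finite G" "finite H" "G \<inter> H = {}"
  shows "degree (G \<union> H) v = degree G v + degree H v"
proof -
  have "{e \<in> G \<union> H. v \<in> e} = {e \<in> G. v \<in> e} \<union> {e \<in> H. v \<in> e}" by auto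
  then show ?thesis
    unfolding degree_def using assms by (simp add: card_Un_disjoint disjoint_iff)
qed

lemma degree_eq_0: "v \<notin> \<Union>G \<Longrightarrow> degree G v = 0"
proof -
  assume "v \<notin> \<Union>G"
  then have "{e \<in> G. v \<in> e} = {}" by auto
  then show ?thesis by (simp only: degree_def card.empty)
qed

section \<open>Attaching a hexagon at one vertex\<close>

locale hexagon_attached =
  fixes G H :: "'a set set" and w :: 'a
  assumes finite_G: "finite G" and card_edge: "\<And>e. e \<in> G \<Longrightarrow> card e = 2"
    and hexagon: "hexagon H" and common: "\<Union>G \<inter> \<Union>H = {w}"
begin

lemma disjoint: "G \<inter> H = {}"
proof -
  have "card e \<noteq> 2" if "e \<in> G" "e \<in> H" for e
  proof -
    have "e \<subseteq> {w}" using that common by blast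
    then have "card e \<le> card {w}" by (intro card_mono) auto
    then show ?thesis by simp
  qed
  then show ?thesis using card_edge by blast
qed

lemma degree_Un: "degree (G \<union> H) v = degree G v + degree H v"
  using degree_Un_disjoint[OF finite_G hexagon_finite[OF hexagon] disjoint] .

lemma finite_edge: "e \<in> G \<union> H \<Longrightarrow> finite e"
  using card_edge hexagon_card_edge[OF hexagon] by (metis UnE card.infinite zero_neq_numeral)

lemma w_in_H: "w \<in> \<Union>H" and w_in_G: "w \<in> \<Union>G"
  using common by auto

lemma edge_sum_old:
  assumes "e \<in> G"
  shows "(\<Sum>v\<in>e. real (degree (G \<union> H) v)) =
    (\<Sum>v\<in>e. real (degree G v)) + (if w \<in> e then 2 else 0)"
proof -
  have "degree H v = (if v = w then 2 else 0)" if "v \<in> e" for v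
    using that assms common hexagon_degree[OF hexagon] degree_eq_0[of v H] w_in_H by auto
  then have "(\<Sum>v\<in>e. real (degree H v)) = (\<Sum>v\<in>e. if v = w then 2 else 0)"
    by (intro sum.cong) auto
  then show ?thesis
    using finite_edge[of e] assms by (simp add: degree_Un sum.distrib)
qed

lemma edge_sum_new:
  assumes "e \<in> H"
  shows "(\<Sum>v\<in>e. real (degree (G \<union> H) v)) = 4 + (if w \<in> e then real (degree G w) else 0)"
proof -
  have "degree G v = (if v = w then degree G w else 0)" if "v \<in> e" for v
    using that assms common degree_eq_0[of v G] by auto
  then have "(\<Sum>v\<in>e. real (degree G v)) = (\<Sum>v\<in>e. if v = w then real (degree G w) else 0)"
    by (intro sum.cong) (auto split: if_splits)
  moreover have "(\<Sum>v\<in>e. real (degree H v)) = (\<Sum>v\<in>e. 2)"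
    using assms hexagon_degree[OF hexagon] by (intro sum.cong) auto
  ultimately show ?thesis
    using finite_edge[of e] assms hexagon_card_edge[OF hexagon assms]
    by (simp add: degree_Un sum.distrib)
qed

text \<open>A new hexagon changes the index in two ways. It brings six edges of its own: the four away from \<open>w\<close>
  contribute \<open>\<surd>4\<close> each, and the two at \<open>w\<close> see the degree that \<open>w\<close> already had. And it raises the degree of
  \<open>w\<close> by 2, which affects precisely the old edges at \<open>w\<close>.\<close>

lemma nirmala_Un:
  "nirmala (G \<union> H) = nirmala G + 8 + 2 * sqrt (4 + real (degree G w)) +
     (\<Sum>e | e \<in> G \<and> w \<in> e. sqrt ((\<Sum>v\<in>e. real (degree G v)) + 2) - sqrt (\<Sum>v\<in>e. real (degree G v)))"
proof -
  let ?s = "\<lambda>e. \<Sum>v\<in>e. real (degree G v)"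
  have finH: "finite H" by (rule hexagon_finite[OF hexagon])
  have "nirmala (G \<union> H) = (\<Sum>e\<in>G. sqrt (\<Sum>v\<in>e. real (degree (G \<union> H) v)))
      + (\<Sum>e\<in>H. sqrt (\<Sum>v\<in>e. real (degree (G \<union> H) v)))"
    unfolding nirmala_def by (rule sum.union_disjoint[OF finite_G finH disjoint])
  also have "(\<Sum>e\<in>G. sqrt (\<Sum>v\<in>e. real (degree (G \<union> H) v))) =
      (\<Sum>e\<in>G. sqrt (?s e) + (if w \<in> e then sqrt (?s e + 2) - sqrt (?s e) else 0))"
    by (intro sum.cong) (auto simp: edge_sum_old)
  also have "\<dots> = nirmala G + (\<Sum>e | e \<in> G \<and> w \<in> e. sqrt (?s e + 2) - sqrt (?s e))"
    using finite_G by (simp add: sum.distrib nirmala_def sum.inter_filter)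
  also have "(\<Sum>e\<in>H. sqrt (\<Sum>v\<in>e. real (degree (G \<union> H) v))) =
      (\<Sum>e\<in>H. 2 + (if w \<in> e then sqrt (4 + real (degree G w)) - 2 else 0))"
    by (intro sum.cong) (auto simp: edge_sum_new)
  also have "\<dots> = 2 * real (card H) + real (degree H w) * (sqrt (4 + real (degree G w)) - 2)"
    using finH by (simp add: sum.distrib degree_def flip: sum.inter_filter)
  also have "\<dots> = 8 + 2 * sqrt (4 + real (degree G w))"
    by (simp add: hexagon_card[OF hexagon] hexagon_degree[OF hexagon w_in_H])
  finally show ?thesis by simp
qed

end

lemma sqrt_8: "sqrt 8 = 2 * sqrt 2"
  using real_sqrt_mult[of 4 2] by simp

lemma hexagon_edge_sum:
  assumes "hexagon H" "e \<in> H"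
  shows "(\<Sum>v\<in>e. real (degree H v)) = 4"
proof -
  have "(\<Sum>v\<in>e. real (degree H v)) = (\<Sum>v\<in>e. 2)"
    using hexagon_degree[OF assms(1)] assms(2) by (intro sum.cong) auto
  then show ?thesis using hexagon_card_edge[OF assms] by simp
qed

lemma nirmala_hexagon: "hexagon H \<Longrightarrow> nirmala H = 12"
  by (simp add: nirmala_def hexagon_card hexagon_edge_sum)

lemma nirmala_two_hexagons:
  assumes "hexagon G" "hexagon H" "\<Union>G \<inter> \<Union>H = {u}"
  shows "nirmala (G \<union> H) = 16 + 4 * sqrt 6"
proof -
  interpret hexagon_attached G H u
    using assms by unfold_locales (auto simp: hexagon_finite hexagon_card_edge)
  have d: "card {e \<in> G. u \<in> e} = 2"
    using hexagon_degree[OF assms(1) w_in_G] by (simp add: degree_def)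
  show ?thesis
    unfolding nirmala_Un using nirmala_hexagon[OF assms(1)] hexagon_degree[OF assms(1) w_in_G]
    by (simp add: hexagon_edge_sum[OF assms(1)] d)
qed

text \<open>The heart of the computation. Here \<open>H'\<close> is the last hexagon of the chain, \<open>u\<close> its junction with the
  preceding part \<open>G0\<close>, and \<open>w\<close> the vertex that receives the new hexagon. The only old edges at \<open>w\<close> are its two
  edges in \<open>H'\<close>. An edge from \<open>w\<close> to a vertex of degree 2 changes its weight from \<open>\<surd>4\<close> to \<open>\<surd>6\<close>, an
  edge from \<open>w\<close> to \<open>u\<close>, which has degree 4, from \<open>\<surd>6\<close> to \<open>\<surd>8\<close>. So all that matters about the position of
  \<open>w\<close> is whether it is adjacent to \<open>u\<close>. The first claim lets the same situation recur at the next step,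
  with \<open>w\<close> in the role of \<open>u\<close>.\<close>

lemma nirmala_attach:
  fixes G0 H' H :: "'a set set"
  assumes old: "hexagon_attached G0 H' u" and deg: "degree G0 u = 2"
    and new: "hexagon_attached (G0 \<union> H') H w" and w: "w \<in> \<Union>H'" "w \<noteq> u"
  shows "degree (G0 \<union> H') w = 2"
    and "nirmala (G0 \<union> H' \<union> H) = nirmala (G0 \<union> H') + 4 + 4 * sqrt 6 +
      (if {u, w} \<in> H' then 2 - 2 * sqrt 6 + 2 * sqrt 2 else 0)"
proof -
  interpret old: hexagon_attached G0 H' u by (rule old)
  interpret new: hexagon_attached "G0 \<union> H'" H w by (rule new)
  have w_notin: "w \<notin> \<Union>G0" using w old.common by blast
  show degw: "degree (G0 \<union> H') w = 2"
    using degree_eq_0[OF w_notin] hexagon_degree[OF old.hexagon w(1)] by (simp add: old.degree_Un)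
  obtain x y where xy: "x \<noteq> y" "x \<noteq> w" "y \<noteq> w" "{e \<in> H'. w \<in> e} = {{w, x}, {w, y}}"
    using hexagon_edges_at[OF old.hexagon w(1)] .
  have "{e \<in> G0 \<union> H'. w \<in> e} = {e \<in> H'. w \<in> e}" using w_notin by auto
  then have edges: "{e. e \<in> G0 \<union> H' \<and> w \<in> e} = {{w, x}, {w, y}}" by (simp add: xy)
  have in_H': "{w, x} \<in> H'" "{w, y} \<in> H'" using xy(4) by auto
  have adj: "{u, w} \<in> H' \<longleftrightarrow> u = x \<or> u = y"
  proof -
    have "{u, w} \<in> H' \<longleftrightarrow> {u, w} \<in> {e \<in> H'. w \<in> e}" by simp
    then show ?thesis unfolding xy(4) using w(2) by (auto simp: doubleton_eq_iff)
  qed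
  have ne: "{w, x} \<noteq> {w, y}" using xy by (auto simp: doubleton_eq_iff)
  have sum_two: "sum g {{w, x}, {w, y}} = g {w, x} + g {w, y}" for g :: "'a set \<Rightarrow> real"
    using ne by simp
  have sums: "(\<Sum>v\<in>{w, z}. real (degree (G0 \<union> H') v)) = 4 + (if u = z then 2 else 0)"
    if "{w, z} \<in> H'" for z
    using old.edge_sum_new[OF that] deg w(2) by auto
  show "nirmala (G0 \<union> H' \<union> H) = nirmala (G0 \<union> H') + 4 + 4 * sqrt 6 +
      (if {u, w} \<in> H' then 2 - 2 * sqrt 6 + 2 * sqrt 2 else 0)"
    unfolding new.nirmala_Un degw edges adj sum_two using xy(1)
    by (auto simp: sums[OF in_H'(1)] sums[OF in_H'(2)] sqrt_8 simp del: sum.insert sum.insert_remove)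
qed

section \<open>Spiro chains\<close>

lemma spiro_hexagons_edges:
  "spiro_hexagons c Hs \<Longrightarrow> finite (\<Union>(set Hs)) \<and> (\<forall>e \<in> \<Union>(set Hs). card e = 2)"
  by (induction rule: spiro_hexagons.induct) (auto simp: hexagon_finite hexagon_card_edge)

text \<open>The invariant that makes \<open>nirmala_attach\<close> applicable along the chain: the last hexagon meets all the
  earlier ones together, and not only its predecessor, in a single vertex, and this vertex had degree 2
  before the last hexagon was attached.\<close>

lemma spiro_hexagons_last_attached:
  assumes "spiro_hexagons c Hs" "Hs = H # H' # Hs'"
  shows "\<exists>u. hexagon_attached (\<Union>(set (H' # Hs'))) H u \<and> \<Union>H \<inter> \<Union>H' = {u} \<and> 
    degree (\<Union>(set (H' # Hs'))) u = 2"
  using assms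
proof (induction arbitrary: H H' Hs' rule: spiro_hexagons.induct)
  case (one H)
  then show ?case by simp
next
  case (two H1 H2 u)
  then show ?case
    by (intro exI[of _ u])
      (auto simp: hexagon_attached_def hexagon_finite hexagon_card_edge Int_commute intro!: hexagon_degree)
next
  case (attach K' K'' Hs u w K)
  obtain u' where u': "hexagon_attached (\<Union>(set (K'' # Hs))) K' u'" "\<Union>K' \<inter> \<Union>K'' = {u'}"
    "degree (\<Union>(set (K'' # Hs))) u' = 2"
    using attach.IH[OF refl] by blast
  have "u' = u" using u'(2) attach.hyps by auto
  (* The new junction differs from the old one since the chosen distance is not 0. *)
  moreover have "w \<noteq> u" using attach.hyps graph_dist_self[of K' u] by auto
  moreover have new: "hexagon_attached (\<Union>(set (K' # K'' # Hs))) K w"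
    using attach.hyps spiro_hexagons_edges[OF attach.hyps(1)]
    by (auto simp: hexagon_attached_def Int_commute)
  moreover have eq: "\<Union>(set (K'' # Hs)) \<union> K' = \<Union>(set (K' # K'' # Hs))" by auto
  ultimately have "degree (\<Union>(set (K' # K'' # Hs))) w = 2"
    using nirmala_attach(1)[OF u'(1) u'(3), of K w] attach.hyps by simp
  moreover have "\<Union>K \<inter> \<Union>K' = {w}" using attach.hyps by auto
  ultimately show ?case using new attach.prems by auto
qed

text \<open>Each hexagon after the second adds \<open>4 + 4\<surd>6\<close>, and the constant \<open>2 - 2\<surd>6 + 2\<surd>2\<close> in addition when it
  is attached next to the previous junction. The steps \<open>3, 4, \<dots>\<close> are numbered from 0 here, as \<open>i + 3\<close>.\<close>

lemma nirmala_spiro_hexagons: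
  assumes "spiro_hexagons c Hs" "length Hs \<ge> 2"
  shows "nirmala (\<Union>(set Hs)) = 8 - 4 * sqrt 6 +
    (2 - 2 * sqrt 6 + 2 * sqrt 2) * real (card {i \<in> {..<length Hs - 2}. c (i + 3) = 1}) +
    (4 + 4 * sqrt 6) * real (length Hs)"
  using assms
proof (induction rule: spiro_hexagons.induct)
  case (one H)
  then show ?case by simp
next
  case (two H1 H2 u)
  then show ?case using nirmala_two_hexagons[OF two(1,2,3)] by (simp add: Un_commute)
next
  case (attach K' K'' Hs u w K)
  let ?G = "\<Union>(set (K' # K'' # Hs))" and ?l = "length Hs"
  let ?ones = "\<lambda>n. {i \<in> {..<n}. c (i + 3) = 1}"
  obtain u' where u': "hexagon_attached (\<Union>(set (K'' # Hs))) K' u'" "\<Union>K' \<inter> \<Union>K'' = {u'}"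
    "degree (\<Union>(set (K'' # Hs))) u' = 2"
    using spiro_hexagons_last_attached[OF attach.hyps(1) refl] by blast
  have uu': "u' = u" using u'(2) attach.hyps by auto
  have wu: "w \<noteq> u" using attach.hyps graph_dist_self[of K' u] by auto
  have new: "hexagon_attached ?G K w"
    using attach.hyps spiro_hexagons_edges[OF attach.hyps(1)]
    by (auto simp: hexagon_attached_def Int_commute)
  have eq: "\<Union>(set (K'' # Hs)) \<union> K' = ?G" by auto
  have hex': "hexagon K'" using u'(1) by (simp add: hexagon_attached_def)
  have adj: "{u, w} \<in> K' \<longleftrightarrow> c (?l + 3) = 1"
    using hexagon_graph_dist_eq_1_iff[OF hex' _ attach.hyps(3) wu] attach.hyps(2,4) by auto
  have "nirmala (?G \<union> K) = nirmala ?G + 4 + 4 * sqrt 6 +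
      (if {u, w} \<in> K' then 2 - 2 * sqrt 6 + 2 * sqrt 2 else 0)"
    using nirmala_attach(2)[OF u'(1,3), of K w] new attach.hyps(3) wu unfolding eq uu' by blast
  moreover have "?ones (Suc ?l) = (if c (?l + 3) = 1 then insert ?l (?ones ?l) else ?ones ?l)"
    by (auto simp: less_Suc_eq)
  then have "card (?ones (Suc ?l)) = card (?ones ?l) + (if c (?l + 3) = 1 then 1 else 0)"
    by simp
  moreover have "\<Union>(set (K # K' # K'' # Hs)) = ?G \<union> K" by auto
  moreover have "length (K # K' # K'' # Hs) - 2 = Suc ?l" "length (K' # K'' # Hs) - 2 = ?l"
    by simp_all
  ultimately show ?case
    using attach.IH adj by (simp only:) (auto simp: algebra_simps)
qed

lemma nirmala_spiro_chain:
  assumes "spiro_chain c n G" "n \<ge> 2"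
  shows "nirmala G = 8 - 4 * sqrt 6 +
    (2 - 2 * sqrt 6 + 2 * sqrt 2) * real (card {i \<in> {..<n - 2}. c (i + 3) = 1}) +
    (4 + 4 * sqrt 6) * real n"
  using assms nirmala_spiro_hexagons by (auto simp: spiro_chain_def)

section \<open>Counting independent successes\<close>

context prob_space
begin

lemma indep_vars_reindex_inj:
  assumes "indep_vars N X (f ` I)" "inj_on f I"
  shows "indep_vars (\<lambda>i. N (f i)) (\<lambda>i. X (f i)) I"
proof -
  have "prob (\<Inter>j\<in>J. A j) = (\<Prod>j\<in>J. prob (A j))"
    if J: "J \<subseteq> I" "J \<noteq> {}" "finite J" 
      and A: "\<forall>j\<in>J. A j \<in> {X (f j) -` B \<inter> space M |B. B \<in> sets (N (f j))}" for J A
  proof -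
    have inj: "inj_on f J" using assms(2) J(1) by (rule inj_on_subset)
    let ?A = "\<lambda>k. A (the_inv_into J f k)"
    have "prob (\<Inter>k\<in>f ` J. ?A k) = (\<Prod>k\<in>f ` J. prob (?A k))"
    proof (rule indep_setsD)
      show "indep_sets (\<lambda>k. {X k -` B \<inter> space M |B. B \<in> sets (N k)}) (f ` I)"
        using assms(1) by (simp add: indep_vars_def2)
    qed (use J A inj in \<open>auto simp: the_inv_into_f_f\<close>)
    then show ?thesis using inj by (simp add: the_inv_into_f_f prod.reindex)
  qed
  moreover have "random_variable (N (f i)) (X (f i))" if "i \<in> I" for i
    using assms(1) that by (auto simp: indep_vars_def2)
  ultimately show ?thesis
    by (auto simp: indep_vars_def2 indep_sets_def Pi_iff measurable_sets)
qed

lemma prob_successes_eq: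
  fixes B :: "'i \<Rightarrow> 'a \<Rightarrow> bool"
  assumes indep: "indep_vars (\<lambda>_. count_space UNIV) B I" and fin: "finite I"
    and p: "\<And>i. i \<in> I \<Longrightarrow> prob {\<omega> \<in> space M. B i \<omega>} = p" and S: "S \<subseteq> I"
  shows "prob {\<omega> \<in> space M. {i \<in> I. B i \<omega>} = S} = p ^ card S * (1 - p) ^ (card I - card S)"
proof (cases "I = {}")
  case True
  then show ?thesis using S by (simp add: prob_space)
next
  case False
  have rv: "B i \<in> measurable M (count_space UNIV)" if "i \<in> I" for i
    using indep that by (auto simp: indep_vars_def2)
  have ev: "{\<omega> \<in> space M. B i \<omega>} \<in> events" if "i \<in> I" for i
    using measurable_sets[OF rv[OF that], of "{True}"]
    by (simp add: vimage_def Int_def conj_commute)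
  have "{\<omega> \<in> space M. {i \<in> I. B i \<omega>} = S} = (\<Inter>i\<in>I. B i -` {i \<in> S} \<inter> space M)"
    using False S by auto
  also have "prob \<dots> = (\<Prod>i\<in>I. prob (B i -` {i \<in> S} \<inter> space M))"
    by (rule indep_varsD_finite[OF indep False fin]) auto
  also have "\<dots> = (\<Prod>i\<in>I. if i \<in> S then p else 1 - p)"
  proof (intro prod.cong refl)
    fix i assume i: "i \<in> I"
    have "B i -` {True} \<inter> space M = {\<omega> \<in> space M. B i \<omega>}"
      "B i -` {False} \<inter> space M = space M - {\<omega> \<in> space M. B i \<omega>}" by auto
    then show "prob (B i -` {i \<in> S} \<inter> space M) = (if i \<in> S then p else 1 - p)"
      using p[OF i] prob_compl[OF ev[OF i]] by simp
  qed
  also have "\<dots> = p ^ card S * (1 - p) ^ (card I - card S)"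
    using S fin by (simp add: prod.If_cases Int_absorb1 card_Diff_subset finite_subset
        flip: Diff_eq)
  finally show ?thesis .
qed

text \<open>The event that exactly \<open>k\<close> trials succeed splits according to the set \<open>S\<close> of successful trials. All
  \<open>card I choose k\<close> possible sets have the same probability by independence.\<close>

lemma distr_card_successes:
  fixes B :: "'i \<Rightarrow> 'a \<Rightarrow> bool"
  assumes indep: "indep_vars (\<lambda>_. count_space UNIV) B I" and fin: "finite I"
    and p: "\<And>i. i \<in> I \<Longrightarrow> prob {\<omega> \<in> space M. B i \<omega>} = p" "p \<in> {0..1}"
  shows "(\<lambda>\<omega>. card {i \<in> I. B i \<omega>}) \<in> measurable M (count_space UNIV)"
    and "distr M (count_space UNIV) (\<lambda>\<omega>. card {i \<in> I. B i \<omega>}) = binomial_pmf (card I) p"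
proof -
  let ?K = "\<lambda>\<omega>. card {i \<in> I. B i \<omega>}"
  have [measurable]: "B i \<in> measurable M (count_space UNIV)" if "i \<in> I" for i
    using indep that by (auto simp: indep_vars_def2)
  have ev: "{\<omega> \<in> space M. {i \<in> I. B i \<omega>} = S} \<in> events" if "S \<subseteq> I" for S
  proof -
    have "{\<omega> \<in> space M. {i \<in> I. B i \<omega>} = S} = {\<omega> \<in> space M. \<forall>i\<in>I. B i \<omega> = (i \<in> S)}"
      using that by auto
    also have "\<dots> \<in> events" using fin by measurable
    finally show ?thesis .
  qed
  have split: "{\<omega> \<in> space M. ?K \<omega> = k} =
      (\<Union>S\<in>{S. S \<subseteq> I \<and> card S = k}. {\<omega> \<in> space M. {i \<in> I. B i \<omega>} = S})" for k
    by auto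
  have finS: "finite {S. S \<subseteq> I \<and> card S = k}" for k
    using fin by simp
  show meas: "?K \<in> measurable M (count_space UNIV)"
  proof (rule measurable_count_space_eq_countable[THEN iffD2])
    show "?K \<in> space M \<rightarrow> UNIV \<and> (\<forall>k\<in>UNIV. ?K -` {k} \<inter> space M \<in> events)"
      using split ev finS by (auto simp: vimage_def Int_def conj_commute intro!: sets.finite_UN)
  qed simp
  have "emeasure (distr M (count_space UNIV) ?K) {k} = emeasure (binomial_pmf (card I) p) {k}" for k
  proof -
    have "prob {\<omega> \<in> space M. ?K \<omega> = k} =
        (\<Sum>S | S \<subseteq> I \<and> card S = k. prob {\<omega> \<in> space M. {i \<in> I. B i \<omega>} = S})"
      unfolding split using ev
      by (intro finite_measure_finite_Union finS) (auto simp: disjoint_family_on_def)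
    also have "\<dots> = (\<Sum>S | S \<subseteq> I \<and> card S = k. p ^ k * (1 - p) ^ (card I - k))"
      using prob_successes_eq[OF indep fin p(1)] by (intro sum.cong) auto
    also have "\<dots> = pmf (binomial_pmf (card I) p) k"
      using p(2) fin by (simp add: n_subsets)
    finally show ?thesis
      using meas by (simp add: emeasure_distr emeasure_pmf_single emeasure_eq_measure
          vimage_def Int_def conj_commute)
  qed
  then show "distr M (count_space UNIV) ?K = binomial_pmf (card I) p"
    by (intro measure_eqI_countable[of _ UNIV]) auto
qed

text \<open>Expectations under a binomial distribution are sums against Bernstein polynomials, and the first two
  factorial moments of these are known from the proof of the Weierstrass approximation theorem.\<close>

lemma binomial_moments:
  fixes a d :: real
  assumes meas: "X \<in> measurable M (count_space UNIV)"
    and distr: "distr M (count_space UNIV) X = binomial_pmf n p" and p: "p \<in> {0..1}"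
  shows "integrable M (\<lambda>\<omega>. (a + d * real (X \<omega>))\<^sup>2)"
    and "expectation (\<lambda>\<omega>. a + d * real (X \<omega>)) = a + d * (real n * p)"
    and "variance (\<lambda>\<omega>. a + d * real (X \<omega>)) = d\<^sup>2 * (real n * p * (1 - p))"
proof -
  have int: "integrable M (\<lambda>\<omega>. g (X \<omega>))" for g :: "nat \<Rightarrow> real"
    using integrable_distr_eq[OF meas, of g] p by (simp add: distr integrable_binomial_pmf)
  have E: "expectation (\<lambda>\<omega>. g (X \<omega>)) = (\<Sum>k\<le>n. g k * Bernstein n k p)" for g :: "nat \<Rightarrow> real"
    using integral_distr[OF meas, of g] p
    by (simp add: distr expectation_binomial_pmf' Bernstein_def mult.commute)
  have E1: "expectation (\<lambda>\<omega>. real (X \<omega>)) = real n * p"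
    using E[of real] by simp
  have "expectation (\<lambda>\<omega>. (real (X \<omega>))\<^sup>2) =
      (\<Sum>k\<le>n. real k * (real k - 1) * Bernstein n k p + real k * Bernstein n k p)"
    unfolding E[of "\<lambda>k. (real k)\<^sup>2"] by (intro sum.cong) (auto simp: power2_eq_square algebra_simps)
  then have E2: "expectation (\<lambda>\<omega>. (real (X \<omega>))\<^sup>2) = real n * (real n - 1) * p\<^sup>2 + real n * p"
    by (simp add: sum.distrib)
  show "integrable M (\<lambda>\<omega>. (a + d * real (X \<omega>))\<^sup>2)" by (rule int)
  show Ea: "expectation (\<lambda>\<omega>. a + d * real (X \<omega>)) = a + d * (real n * p)"
    using int[of real] E1 by (simp add: prob_space)
  have "variance (\<lambda>\<omega>. a + d * real (X \<omega>)) = d\<^sup>2 * variance (\<lambda>\<omega>. real (X \<omega>))"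
  proof -
    have "(a + d * real (X \<omega>) - (a + d * (real n * p)))\<^sup>2 = d\<^sup>2 * (real (X \<omega>) - real n * p)\<^sup>2" for \<omega>
      by (simp add: power2_eq_square algebra_simps)
    then show ?thesis unfolding Ea E1 by simp
  qed
  also have "variance (\<lambda>\<omega>. real (X \<omega>)) = real n * p * (1 - p)"
    by (subst variance_eq[OF int[of real] int[of "\<lambda>k. (real k)\<^sup>2"]])
      (simp only: E1 E2, simp add: power2_eq_square algebra_simps)
  finally show "variance (\<lambda>\<omega>. a + d * real (X \<omega>)) = d\<^sup>2 * (real n * p * (1 - p))" .
qed

text \<open>The factor \<open>d\<close> does not cancel against the square root of its square: a negative \<open>d\<close> reflects the
  standardised count. The central limit theorem is therefore applied to the summands \<open>d\<close> times the indicator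
  of success, whatever the sign of \<open>d\<close>.\<close>

lemma de_Moivre_Laplace:
  fixes d :: real
  assumes indep: "indep_vars (\<lambda>_. count_space UNIV) B (UNIV :: nat set)"
    and prob: "\<And>i. prob {\<omega> \<in> space M. B i \<omega>} = p" and p: "0 < p" "p < 1" and d: "d \<noteq> 0"
  shows "weak_conv_m (\<lambda>n. distr M borel (\<lambda>\<omega>.
      d * (real (card {i \<in> {..<n}. B i \<omega>}) - real n * p) / sqrt (d\<^sup>2 * (real n * p * (1 - p)))))
    std_normal_distribution"
proof -
  (* The indicator of trial i is written as the number of successes among the trials in {i}, so that its
     distribution and moments are those of a binomial count. *)
  let ?X = "\<lambda>i \<omega>. d * real (card {j \<in> {i}. B j \<omega>})"
  define \<sigma> where "\<sigma> = \<bar>d\<bar> * sqrt (p * (1 - p))"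
  have \<sigma>2: "\<sigma>\<^sup>2 = d\<^sup>2 * (p * (1 - p))"
    using p by (simp add: \<sigma>_def power_mult_distrib)
  have indep_i: "indep_vars (\<lambda>_. count_space UNIV) B {i}" for i
    using indep by (rule indep_vars_subset) simp
  have p01: "p \<in> {0..1}" using p by simp
  have single: "(\<lambda>\<omega>. card {j \<in> {i}. B j \<omega>}) \<in> measurable M (count_space UNIV)"
    "distr M (count_space UNIV) (\<lambda>\<omega>. card {j \<in> {i}. B j \<omega>}) = binomial_pmf 1 p" for i
  proof -
    have *: "finite {i}" "\<And>j. j \<in> {i} \<Longrightarrow> prob {\<omega> \<in> space M. B j \<omega>} = p" "card {i} = 1"
      by (auto simp: prob)
    show "(\<lambda>\<omega>. card {j \<in> {i}. B j \<omega>}) \<in> measurable M (count_space UNIV)"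
      using distr_card_successes(1)[OF indep_i[of i] *(1,2) p01] .
    show "distr M (count_space UNIV) (\<lambda>\<omega>. card {j \<in> {i}. B j \<omega>}) = binomial_pmf 1 p"
      using distr_card_successes(2)[OF indep_i[of i] *(1,2) p01] unfolding *(3) .
  qed
  have X_eq: "?X i \<omega> = d * of_bool (B i \<omega>)" for i \<omega>
  proof -
    have "{j \<in> {i}. B j \<omega>} = (if B i \<omega> then {i} else {})" by auto
    then show ?thesis by simp
  qed
  have "weak_conv_m (\<lambda>n. distr M borel (\<lambda>\<omega>. (\<Sum>i<n. ?X i \<omega> - d * p) / sqrt (real n * \<sigma>\<^sup>2)))
    std_normal_distribution"
  proof (rule central_limit_theorem)
    show "indep_vars (\<lambda>_. borel) ?X UNIV"
      unfolding X_eq by (rule indep_vars_compose2[OF indep]) simp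
    show "0 < \<sigma>" using p d by (simp add: \<sigma>_def)
    show "expectation (?X i) = d * p" for i
      using binomial_moments(2)[OF single[of i] p01, of 0 d] by simp
    show "integrable M (\<lambda>\<omega>. (?X i \<omega>)\<^sup>2)" for i
      using binomial_moments(1)[OF single[of i] p01, of 0 d] by simp
    show "variance (?X i) = \<sigma>\<^sup>2" for i
      using binomial_moments(3)[OF single[of i] p01, of 0 d] \<sigma>2 by simp
    show "distr M borel (?X i) = distr (binomial_pmf 1 p) borel (\<lambda>k. d * real k)" for i
      using distr_distr[OF _ single(1)[of i], of "\<lambda>k. d * real k" borel] single(2)[of i]
      by (simp add: comp_def)
  qed
  moreover have "(\<Sum>i<n. ?X i \<omega> - d * p) = d * (real (card {i \<in> {..<n}. B i \<omega>}) - real n * p)"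
    for n \<omega>
  proof -
    have "(\<Sum>i<n. of_bool (B i \<omega>)) = real (card {i \<in> {..<n}. B i \<omega>})"
      by (simp add: Int_def)
    moreover have "(\<Sum>i<n. ?X i \<omega> - d * p) = d * (\<Sum>i<n. of_bool (B i \<omega>)) - real n * (d * p)"
      unfolding X_eq sum_subtractf sum_distrib_left by simp
    ultimately show ?thesis by (simp only:) (simp add: algebra_simps)
  qed
  ultimately show ?thesis by (simp add: \<sigma>2 mult_ac)
qed

end

section \<open>The Nirmala index of a random spiro chain\<close>

text \<open>A nonzero step is what makes the index genuinely random, so that it can be standardised.\<close>

lemma nirmala_step_neq_0: "2 - 2 * sqrt 6 + 2 * sqrt 2 \<noteq> (0::real)"
proof
  assume "2 - 2 * sqrt 6 + 2 * sqrt 2 = (0::real)"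
  then have "sqrt 6 = 1 + sqrt 2" by linarith
  then have "(sqrt 6)\<^sup>2 = (1 + sqrt 2)\<^sup>2" by simp
  then have "2 * sqrt 2 = (3::real)" by (simp add: power2_sum)
  then have "(2 * sqrt 2)\<^sup>2 = (3::real)\<^sup>2" by simp
  then show False by (simp add: power_mult_distrib)
qed

lemma weak_conv_m_offset:
  assumes "weak_conv_m (\<lambda>n. \<mu> (n + k)) \<nu>"
  shows "weak_conv_m \<mu> \<nu>"
  using assms unfolding weak_conv_m_def weak_conv_def by (blast intro: LIMSEQ_offset)

context random_spiro_chain
begin

lemma indep_vars_adjacent: "indep_vars (\<lambda>_. count_space UNIV) (\<lambda>i \<omega>. C (i + 3) \<omega> = 1) (UNIV :: nat set)"
proof -
  have "n \<in> range (\<lambda>i. i + 3)" if "n \<ge> 3" for n :: nat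
    using that by (intro image_eqI[of _ _ "n - 3"]) auto
  then have "range (\<lambda>i. i + 3) = {3::nat..}" by auto
  then have "indep_vars (\<lambda>_. count_space {1, 2, 3}) C (range (\<lambda>i. i + 3))"
    using indep by simp
  then have "indep_vars (\<lambda>_. count_space {1, 2, 3}) (\<lambda>i. C (i + 3)) UNIV"
    by (rule indep_vars_reindex_inj) (auto simp: inj_on_def)
  then show ?thesis by (rule indep_vars_compose2) auto
qed

lemma prob_adjacent: "prob {\<omega> \<in> space M. C (i + 3) \<omega> = 1} = p1"
  by (rule prob_C(1)) simp

end

theorem corollary2:
  fixes M :: "'w measure" and p1 p2 p3 :: real
    and C :: "nat \<Rightarrow> 'w \<Rightarrow> nat" and RSC :: "nat \<Rightarrow> 'w \<Rightarrow> 'a set set"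
    and N :: "nat \<Rightarrow> 'w \<Rightarrow> real"
  assumes "random_spiro_chain M p1 p2 p3 C RSC"
    and "N = (\<lambda>n \<omega>. nirmala (RSC n \<omega>))"
  shows "(\<forall>n\<ge>2.
      (\<exists>X :: 'w \<Rightarrow> nat. X \<in> measurable M (count_space UNIV) \<and>
        distr M (count_space UNIV) X = measure_pmf (binomial_pmf (n - 2) p1) \<and>
        (\<forall>\<omega>\<in>space M. N n \<omega> =
          8 - 4 * sqrt 6 + (2 - 2 * sqrt 6 + 2 * sqrt 2) * real (X \<omega>) + (4 + 4 * sqrt 6) * real n)) \<and>
      prob_space.expectation M (N n) =
        8 - 4 * sqrt 6 + ((2 - 2 * sqrt 6 + 2 * sqrt 2) * p1 + 4 + 4 * sqrt 6) * real n
          - 2 * (2 - 2 * sqrt 6 + 2 * sqrt 2) * p1 \<and>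
      prob_space.variance M (N n) =
        (2 - 2 * sqrt 6 + 2 * sqrt 2)\<^sup>2 * p1 * (1 - p1) * (real n - 2)) \<and>
    weak_conv_m
      (\<lambda>n. distr M borel
        (\<lambda>\<omega>. (N n \<omega> - prob_space.expectation M (N n)) / sqrt (prob_space.variance M (N n))))
      std_normal_distribution"
proof -
  interpret random_spiro_chain M p1 p2 p3 C RSC by (rule assms(1))
  define d :: real where "d = 2 - 2 * sqrt 6 + 2 * sqrt 2"
  define a where "a n = 8 - 4 * sqrt 6 + (4 + 4 * sqrt 6) * real n" for n
  define X where "X m \<omega> = card {i \<in> {..<m}. C (i + 3) \<omega> = 1}" for m \<omega>
  have p01: "p1 \<in> {0..1}" using p1 by simp
  have indep_m: "indep_vars (\<lambda>_. count_space UNIV) (\<lambda>i \<omega>. C (i + 3) \<omega> = 1) {..<m}" for m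
    using indep_vars_adjacent by (rule indep_vars_subset) simp
  have X: "X m \<in> measurable M (count_space UNIV)"
    "distr M (count_space UNIV) (X m) = binomial_pmf m p1" for m
    using distr_card_successes[OF indep_m finite_lessThan prob_adjacent p01, of m]
    by (simp_all only: X_def[abs_def] card_lessThan)
  have N: "N n \<omega> = a n + d * real (X (n - 2) \<omega>)" if "n \<ge> 2" "\<omega> \<in> space M" for n \<omega>
    using nirmala_spiro_chain[OF RSC[of n \<omega>]] that
    by (simp add: assms(2) a_def d_def X_def)
  have "expectation (N n) = expectation (\<lambda>\<omega>. a n + d * real (X (n - 2) \<omega>))" if "n \<ge> 2" for n
    using that by (intro Bochner_Integration.integral_cong) (simp_all add: N)
  then have E: "expectation (N n) = a n + d * (real (n - 2) * p1)" if "n \<ge> 2" for n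
    using that binomial_moments(2)[OF X p01] by simp
  have "variance (N n) = variance (\<lambda>\<omega>. a n + d * real (X (n - 2) \<omega>))" if "n \<ge> 2" for n
    using that binomial_moments(2)[OF X p01]
    by (intro Bochner_Integration.integral_cong) (simp_all add: N E)
  then have V: "variance (N n) = d\<^sup>2 * (real (n - 2) * p1 * (1 - p1))" if "n \<ge> 2" for n
    using that binomial_moments(3)[OF X p01] by simp
  have "weak_conv_m (\<lambda>n. distr M borel (\<lambda>\<omega>.
      d * (real (X n \<omega>) - real n * p1) / sqrt (d\<^sup>2 * (real n * p1 * (1 - p1)))))
    std_normal_distribution"
    unfolding X_def
    by (rule de_Moivre_Laplace[OF indep_vars_adjacent prob_adjacent p1]) (simp add: d_def nirmala_step_neq_0)
  also have "(\<lambda>n. distr M borel (\<lambda>\<omega>.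
      d * (real (X n \<omega>) - real n * p1) / sqrt (d\<^sup>2 * (real n * p1 * (1 - p1))))) =
    (\<lambda>n. distr M borel (\<lambda>\<omega>. (N (n + 2) \<omega> - expectation (N (n + 2))) / sqrt (variance (N (n + 2)))))"
  proof (intro ext distr_cong refl)
    fix n :: nat and \<omega> assume \<omega>: "\<omega> \<in> space M"
    have n: "2 \<le> n + 2" by simp
    show "d * (real (X n \<omega>) - real n * p1) / sqrt (d\<^sup>2 * (real n * p1 * (1 - p1))) =
        (N (n + 2) \<omega> - expectation (N (n + 2))) / sqrt (variance (N (n + 2)))"
      unfolding V[OF n] unfolding E[OF n] N[OF n \<omega>] by (simp add: right_diff_distrib)
  qed
  finally have clt: "weak_conv_m
      (\<lambda>n. distr M borel (\<lambda>\<omega>. (N n \<omega> - expectation (N n)) / sqrt (variance (N n))))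
      std_normal_distribution"
    by (rule weak_conv_m_offset)
  have "\<exists>Y. Y \<in> measurable M (count_space UNIV) \<and>
        distr M (count_space UNIV) Y = measure_pmf (binomial_pmf (n - 2) p1) \<and>
        (\<forall>\<omega>\<in>space M. N n \<omega> = 8 - 4 * sqrt 6 + d * real (Y \<omega>) + (4 + 4 * sqrt 6) * real n)"
    if "n \<ge> 2" for n
    using X[of "n - 2"] N[OF that] by (intro exI[of _ "X (n - 2)"]) (simp add: a_def)
  moreover have "expectation (N n) = 8 - 4 * sqrt 6 + (d * p1 + 4 + 4 * sqrt 6) * real n - 2 * d * p1"
    if "n \<ge> 2" for n
    using that unfolding E[OF that] by (simp add: a_def of_nat_diff algebra_simps)
  moreover have "variance (N n) = d\<^sup>2 * p1 * (1 - p1) * (real n - 2)" if "n \<ge> 2" for n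
    using that unfolding V[OF that] by (simp add: of_nat_diff)
  ultimately show ?thesis using clt unfolding d_def by blast
qed

end
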